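(* There exists an absolute constant $c>0$ such that the following holds. Let $d,n\ge 1$ be integers and let $\mathbf{X}_1,\ldots,\mathbf{X}_n$ be random vectors in $\mathbb{R}^d$ on a common probability space, with $\mathcal{F}_i=\sigma(\mathbf{X}_1,\ldots,\mathbf{X}_i)$ the $\sigma$-algebra generated by $\mathbf{X}_1,\ldots,\mathbf{X}_i$ for $i\in\{1,\ldots,n\}$, and $\mathcal{F}_0$ the trivial $\sigma$-algebra. Let $\sigma_1,\ldots,\sigma_n$ be positive real random variables such that $\sigma_i$ is $\mathcal{F}_{i-1}$-measurable for each $i$, and suppose that for every $i\in\{1,\ldots,n\}$, almost surely, $$\mathbb{E}[\mathbf{X}_i\mid\mathcal{F}_{i-1}]=0,\qquad \mathbb{P}\left(\|\mathbf{X}_i\|\ge t\mid\mathcal{F}_{i-1}\right)\le 2e^{-\frac{t^2}{2\sigma_i^2}}\quad\text{for all } t\ge 0.$$ Then for any fixed $\delta>0$ and $\theta>0$, with probability at least $1-\delta$, $$\left\|\sum_{i=1}^n\mathbf{X}_i\right\|\le c\cdot\theta\sum_{i=1}^n\sigma_i^2+\frac{1}{\theta}\log\frac{2d}{\delta}.$$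
   Context: $\|\cdot\|$ is the Euclidean norm on $\mathbb{R}^d$ and $\log$ is the natural logarithm. "Absolute constant" means that $c$ does not depend on $d$, $n$, $\delta$, $\theta$, the $\sigma_i$, or the distribution of the vectors. The numbers $\delta,\theta$ are deterministic; the $\sigma_i$ may be random. *)

theory Defs
  imports "HOL-Probability.Probability"
begin

text \<open>
  The dimension d is quantified inside the existential over the constant, so vectors are
  extensional functions on \<open>{..<d}\<close> rather than elements of a Cartesian power type. The
  product \<open>\<sigma>\<close>-algebra below is the Borel \<open>\<sigma>\<close>-algebra of d-dimensional Euclidean space.
\<close>

definition Rd :: "nat \<Rightarrow> (nat \<Rightarrow> real) measure" where
  "Rd d = PiM {..<d} (\<lambda>_. borel)"

definition enorm :: "nat \<Rightarrow> (nat \<Rightarrow> real) \<Rightarrow> real" where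
  "enorm d x = L2_set x {..<d}"

text \<open>For \<open>i = 0\<close> the generator is empty, which gives the trivial \<open>\<sigma>\<close>-algebra.\<close>

definition history ::
    "'a measure \<Rightarrow> nat \<Rightarrow> (nat \<Rightarrow> 'a \<Rightarrow> nat \<Rightarrow> real) \<Rightarrow> nat \<Rightarrow> 'a measure" where
  "history M d X i =
     sigma (space M) (\<Union>k\<in>{1..i}. {X k -` B \<inter> space M | B. B \<in> sets (Rd d)})"

text \<open>
  The conditional expectation of a vector is taken coordinatewise, and a conditional probability is
  the conditional expectation of an indicator. The latter is only determined up to a null set
  depending on \<open>t\<close>, hence the quantifier over \<open>t\<close> stands outside \<open>AE\<close>; by monotonicity in \<open>t\<close> this
  agrees with the bound holding simultaneously for all \<open>t\<close> for a regular version.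

  No integrability of \<open>X i\<close> is assumed: \<open>real_cond_exp\<close> is the difference of the conditional
  expectations of positive and negative part, both of which are almost surely finite under the
  tail condition, even if the random \<open>\<sigma> i\<close> is unbounded.
\<close>

definition norm_subgaussian_mds ::
    "'a measure \<Rightarrow> nat \<Rightarrow> nat \<Rightarrow> (nat \<Rightarrow> 'a \<Rightarrow> nat \<Rightarrow> real) \<Rightarrow> (nat \<Rightarrow> 'a \<Rightarrow> real) \<Rightarrow> bool" where
  "norm_subgaussian_mds M d n X \<sigma> \<longleftrightarrow>
     (\<forall>i\<in>{1..n}.
        X i \<in> M \<rightarrow>\<^sub>M Rd d \<and>
        \<sigma> i \<in> borel_measurable (history M d X (i - 1)) \<and>
        (\<forall>\<omega>\<in>space M. 0 < \<sigma> i \<omega>) \<and>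
        (\<forall>j<d. AE \<omega> in M. real_cond_exp M (history M d X (i - 1)) (\<lambda>\<omega>. X i \<omega> j) \<omega> = 0) \<and>
        (\<forall>t\<ge>0. AE \<omega> in M.
           real_cond_exp M (history M d X (i - 1))
             (indicator {\<omega> \<in> space M. t \<le> enorm d (X i \<omega>)}) \<omega>
           \<le> 2 * exp (- (t\<^sup>2 / (2 * (\<sigma> i \<omega>)\<^sup>2)))))"

definition norm_sum_bound :: "'a itself \<Rightarrow> real \<Rightarrow> bool" where
  "norm_sum_bound _ c \<longleftrightarrow>
     (\<forall>(M :: 'a measure) (d :: nat) (n :: nat) X \<sigma> (\<delta> :: real) (\<theta> :: real).
        prob_space M \<longrightarrow> 1 \<le> d \<longrightarrow> 1 \<le> n \<longrightarrow> norm_subgaussian_mds M d n X \<sigma> \<longrightarrow>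
        0 < \<delta> \<longrightarrow> 0 < \<theta> \<longrightarrow>
        1 - \<delta> \<le> measure M {\<omega> \<in> space M.
          enorm d (\<lambda>j. \<Sum>i\<in>{1..n}. X i \<omega> j)
            \<le> c * (\<theta> * (\<Sum>i\<in>{1..n}. (\<sigma> i \<omega>)\<^sup>2)) + 1 / \<theta> * ln (2 * real d / \<delta>)})"

text \<open>
  A type variable is fixed before any existential quantifier, so \<open>\<exists>c>0. norm_sum_bound TYPE('a) c\<close>
  alone would let \<open>c\<close> depend on the type of the sample space. To have one constant for all sample
  spaces, \<open>c\<close> is chosen for the type below, which contains no type variable and carries every
  joint distribution of finitely many random vectors; every such \<open>c\<close> is then claimed to work for
  an arbitrary type \<open>'a\<close>.
\<close>

type_synonym canonical = "nat \<Rightarrow> nat \<Rightarrow> real"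

end

theory Submission
  imports Defs
begin

text \<open>
  Write \<open>S\<^sub>i = X\<^sub>1 + \<dots> + X\<^sub>i\<close>. The proof follows Pinelis: the function
  \<open>x \<mapsto> cosh (\<theta> \<parallel>x\<parallel>)\<close> on a Euclidean space is smooth enough that
  \<open>Z\<^sub>i = exp (- c \<theta>\<^sup>2 (\<sigma>\<^sub>1\<^sup>2 + \<dots> + \<sigma>\<^sub>i\<^sup>2)) cosh (\<theta> \<parallel>S\<^sub>i\<parallel>)\<close> is a supermartingale with
  \<open>Z\<^sub>0 = 1\<close>, for \<open>c = 26\<close>. Since \<open>exp u \<le> 2 cosh u\<close>, Markov's inequality for \<open>Z\<^sub>n\<close> yields
  \<open>\<parallel>S\<^sub>n\<parallel> \<le> c \<theta> (\<sigma>\<^sub>1\<^sup>2 + \<dots> + \<sigma>\<^sub>n\<^sup>2) + ln (2 / \<delta>) / \<theta>\<close> outside an event of probability \<open>\<delta>\<close>.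
  This is free of the dimension, hence implies the bound with \<open>ln (2 d / \<delta>)\<close>.

  The supermartingale step needs two inequalities. The first, \<open>cosh_enorm_add_le\<close>, is deterministic:
  \<open>cosh \<parallel>s + x\<parallel> \<le> cosh \<parallel>s\<parallel> (exp \<parallel>x\<parallel> - \<parallel>x\<parallel>) + (sinh \<parallel>s\<parallel> / \<parallel>s\<parallel>) (s \<bullet> x)\<close>.
  The last term is linear in \<open>x\<close>, so it disappears in conditional expectation; what is left of the
  increment has no first-order part, because \<open>exp y - y = 1 + O(y\<^sup>2)\<close>. The second bounds the
  conditional expectation of \<open>exp (\<theta> \<parallel>X\<^sub>i\<parallel>) - \<theta> \<parallel>X\<^sub>i\<parallel>\<close> by \<open>exp (c \<theta>\<^sup>2 \<sigma>\<^sub>i\<^sup>2)\<close>: pointwise, by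
  \<open>exp_minus_le_subgaussian\<close>, the function is at most an affine function of
  \<open>exp (\<parallel>X\<^sub>i\<parallel>\<^sup>2 / (4 \<sigma>\<^sub>i\<^sup>2))\<close>, and the tail condition bounds the conditional expectation of the
  latter by \<open>3\<close>. The two are combined in \<open>nn_integral_cosh_enorm_step_le\<close>.

  The argument works over every sample space. The second conjunct is about an arbitrary \<open>c\<close>,
  possibly smaller than 26, so it does not follow from this; it is proved by replacing a sample space
  by the joint distribution of the vectors. Both hypothesis and conclusion depend on that
  distribution only, once each \<open>\<sigma>\<^sub>i\<close> is written as a function of the vectors.
\<close>

section \<open>The hyperbolic cosine of the norm of a sum\<close>

lemma cosh_sqrt_sums:
  fixes u :: real
  assumes "0 \<le> u"
  shows "(\<lambda>k. u ^ k / fact (2 * k)) sums cosh (sqrt u)"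
proof -
  define f where "f = (\<lambda>m::nat. if even m then sqrt u ^ m /\<^sub>R fact m else 0)"
  have "strict_mono (\<lambda>k::nat. 2 * k)"
    by (simp add: strict_mono_def)
  moreover have "f m = 0" if "m \<notin> range (\<lambda>k::nat. 2 * k)" for m
    using that unfolding f_def by (auto elim!: evenE)
  ultimately have "(\<lambda>k. f (2 * k)) sums cosh (sqrt u) \<longleftrightarrow> f sums cosh (sqrt u)"
    by (rule sums_mono_reindex)
  moreover have "sqrt u ^ (2 * k) = u ^ k" for k
    using assms by (simp only: power_mult real_sqrt_pow2)
  then have "f (2 * k) = u ^ k / fact (2 * k)" for k
    by (simp add: f_def divide_inverse mult.commute)
  ultimately show ?thesis
    using cosh_converges[of "sqrt u"] by (simp add: f_def)
qed

lemma convex_on_power_nonneg: "convex_on {0::real..} (\<lambda>u. u ^ k)"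
proof (cases "even k")
  case True
  then show ?thesis
    by (rule convex_on_subset[OF convex_power_even]) auto
qed (rule convex_power_odd)

text \<open>
  The power series in \<open>u\<close> has nonnegative coefficients, so convexity is inherited from the powers.
\<close>

lemma convex_on_cosh_sqrt: "convex_on {0::real..} (\<lambda>u. cosh (sqrt u))"
proof (rule convex_onI)
  fix t u v :: real
  assume t: "0 < t" "t < 1" and uv: "u \<in> {0..}" "v \<in> {0..}"
  define w where "w = (1 - t) *\<^sub>R u + t *\<^sub>R v"
  have w: "0 \<le> w"
    using t uv by (simp add: w_def)
  have "w ^ k \<le> (1 - t) * u ^ k + t * v ^ k" for k
    using convex_onD[OF convex_on_power_nonneg, of t u v] t uv by (simp add: w_def)
  then have "w ^ k / fact (2 * k) \<le> (1 - t) * (u ^ k / fact (2 * k)) + t * (v ^ k / fact (2 * k))" for k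
    by (simp add: divide_right_mono flip: add_divide_distrib)
  moreover have "(\<lambda>k. (1 - t) * (u ^ k / fact (2 * k)) + t * (v ^ k / fact (2 * k)))
      sums ((1 - t) * cosh (sqrt u) + t * cosh (sqrt v))"
    using uv by (intro sums_add sums_mult cosh_sqrt_sums) auto
  ultimately have "cosh (sqrt w) \<le> (1 - t) * cosh (sqrt u) + t * cosh (sqrt v)"
    by (rule sums_le[OF _ cosh_sqrt_sums[OF w]])
  then show "cosh (sqrt ((1 - t) *\<^sub>R u + t *\<^sub>R v)) \<le> (1 - t) * cosh (sqrt u) + t * cosh (sqrt v)"
    by (simp add: w_def)
qed (rule convex_real_interval)

lemma le_sinh:
  fixes b :: real
  assumes "0 \<le> b"
  shows "b \<le> sinh b"
proof -
  have "sinh 0 - 0 \<le> sinh b - b"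
  proof (rule DERIV_nonneg_imp_nondecreasing[OF assms])
    fix x :: real
    show "\<exists>y. ((\<lambda>b. sinh b - b) has_real_derivative y) (at x) \<and> 0 \<le> y"
      by (rule exI[of _ "cosh x - 1"]) (auto intro!: derivative_eq_intros cosh_real_ge_1)
  qed
  then show ?thesis by simp
qed

lemma cosh_add_le:
  fixes a b :: real
  assumes "0 \<le> b"
  shows "cosh (a + b) \<le> cosh a * (exp b - b) + b * sinh a"
proof -
  have "0 \<le> (cosh a - sinh a) * (sinh b - b)"
    using le_sinh[OF assms] by (simp add: cosh_minus_sinh)
  moreover have "exp b = cosh b + sinh b"
    by (simp add: cosh_plus_sinh)
  ultimately show ?thesis
    by (simp add: cosh_add algebra_simps)
qed

lemma cosh_diff_le:
  fixes a b :: real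
  assumes "0 \<le> b"
  shows "cosh (a - b) \<le> cosh a * (exp b - b) - b * sinh a"
proof -
  have "cosh (b - a) \<le> cosh a * (exp b - b) - b * sinh a"
    using cosh_add_le[OF assms, of "- a"] by simp
  then show ?thesis
    using cosh_minus[of "b - a"] by (simp only: minus_diff_eq)
qed

text \<open>
  Here \<open>a\<close> and \<open>b\<close> are the lengths of two vectors and \<open>p\<close> is their inner product. As a function
  of \<open>p\<close> the left-hand side is convex and the right-hand side is affine, so it suffices to compare
  them at \<open>p = \<plusminus> a * b\<close>, where the vectors are parallel; these cases are \<open>cosh_add_le\<close> and
  \<open>cosh_diff_le\<close>.
\<close>

lemma cosh_sqrt_law_of_cosines_le:
  fixes a b p :: real
  assumes "0 \<le> a" "0 \<le> b" "\<bar>p\<bar> \<le> a * b"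
  shows "cosh (sqrt (a\<^sup>2 + 2 * p + b\<^sup>2)) \<le> cosh a * (exp b - b) + sinh a / a * p"
proof (cases "a * b = 0")
  case True
  then have "p = 0" using assms by auto
  with True show ?thesis
    using assms cosh_add_le[of b 0] by auto
next
  case False
  with assms have pos: "0 < a" "0 < b" by auto
  define r where "r = p / (a * b)"
  have r: "\<bar>r\<bar> \<le> 1" and p: "p = r * (a * b)"
    using pos assms by (simp_all add: r_def abs_divide)
  define t where "t = (1 - r) / 2"
  have "cosh (sqrt ((1 - t) * (a + b)\<^sup>2 + t * (a - b)\<^sup>2))
      \<le> (1 - t) * cosh (sqrt ((a + b)\<^sup>2)) + t * cosh (sqrt ((a - b)\<^sup>2))"
    using convex_onD[OF convex_on_cosh_sqrt, of t "(a + b)\<^sup>2" "(a - b)\<^sup>2"] r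
    by (simp add: t_def)
  also have "\<dots> = (1 - t) * cosh (a + b) + t * cosh (a - b)"
    using pos by simp
  also have "\<dots> \<le> (1 - t) * (cosh a * (exp b - b) + b * sinh a)
                 + t * (cosh a * (exp b - b) - b * sinh a)"
    using r pos by (intro add_mono mult_left_mono cosh_add_le cosh_diff_le) (auto simp: t_def)
  also have "\<dots> = cosh a * (exp b - b) + sinh a / a * p"
    using pos by (simp add: t_def p field_simps)
  also have "(1 - t) * (a + b)\<^sup>2 + t * (a - b)\<^sup>2 = a\<^sup>2 + 2 * p + b\<^sup>2"
    by (simp add: t_def p power2_eq_square field_simps)
  finally show ?thesis .
qed


lemma borel_measurable_cosh [measurable (raw)]:
  fixes f :: "'a \<Rightarrow> real"
  assumes "f \<in> borel_measurable M"
  shows "(\<lambda>x. cosh (f x)) \<in> borel_measurable M"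
  unfolding cosh_def using assms by measurable

lemma borel_measurable_sinh [measurable (raw)]:
  fixes f :: "'a \<Rightarrow> real"
  assumes "f \<in> borel_measurable M"
  shows "(\<lambda>x. sinh (f x)) \<in> borel_measurable M"
  unfolding sinh_def using assms by measurable

lemma enorm_nonneg: "0 \<le> enorm d x"
  by (simp add: enorm_def)

lemma enorm_power2: "(enorm d x)\<^sup>2 = (\<Sum>j<d. (x j)\<^sup>2)"
  by (simp add: enorm_def L2_set_def sum_nonneg)

lemma abs_le_enorm:
  assumes "j < d"
  shows "\<bar>x j\<bar> \<le> enorm d x"
proof (rule power2_le_imp_le[OF _ enorm_nonneg])
  show "\<bar>x j\<bar>\<^sup>2 \<le> (enorm d x)\<^sup>2"
    unfolding enorm_power2 power2_abs
    by (rule member_le_sum[of j "{..<d}" "\<lambda>j. (x j)\<^sup>2"]) (use assms in auto)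
qed

lemma borel_measurable_enorm:
  assumes "\<And>j. j < d \<Longrightarrow> (\<lambda>\<omega>. f \<omega> j) \<in> borel_measurable M"
  shows "(\<lambda>\<omega>. enorm d (f \<omega>)) \<in> borel_measurable M"
  unfolding enorm_def L2_set_def using assms by measurable

lemma abs_inner_le_enorm: "\<bar>\<Sum>j<d. s j * x j\<bar> \<le> enorm d s * enorm d x"
proof -
  have "\<bar>\<Sum>j<d. s j * x j\<bar> \<le> (\<Sum>j<d. \<bar>s j\<bar> * \<bar>x j\<bar>)"
    by (rule order_trans[OF sum_abs]) (simp add: abs_mult)
  then show ?thesis
    using L2_set_mult_ineq[of s x "{..<d}"] by (simp add: enorm_def)
qed

lemma enorm_add_power2:
  "(enorm d (\<lambda>j. s j + x j))\<^sup>2 = (enorm d s)\<^sup>2 + 2 * (\<Sum>j<d. s j * x j) + (enorm d x)\<^sup>2"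
  by (simp add: enorm_power2 power2_sum sum.distrib sum_distrib_left algebra_simps)

lemma cosh_enorm_add_le:
  fixes \<theta> :: real
  assumes "0 < \<theta>"
  shows "cosh (\<theta> * enorm d (\<lambda>j. s j + x j))
    \<le> cosh (\<theta> * enorm d s) * (exp (\<theta> * enorm d x) - \<theta> * enorm d x)
      + (\<Sum>j<d. sinh (\<theta> * enorm d s) / (\<theta> * enorm d s) * \<theta>\<^sup>2 * s j * x j)"
proof -
  define p where "p = \<theta>\<^sup>2 * (\<Sum>j<d. s j * x j)"
  have "\<bar>p\<bar> \<le> (\<theta> * enorm d s) * (\<theta> * enorm d x)"
    using mult_left_mono[OF abs_inner_le_enorm[of s x d], of "\<theta>\<^sup>2"]
    by (simp add: p_def abs_mult power2_eq_square mult_ac)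
  note le = cosh_sqrt_law_of_cosines_le[OF _ _ this]
  have "(\<theta> * enorm d (\<lambda>j. s j + x j))\<^sup>2 = (\<theta> * enorm d s)\<^sup>2 + 2 * p + (\<theta> * enorm d x)\<^sup>2"
    by (simp add: p_def power_mult_distrib enorm_add_power2 algebra_simps)
  then have "\<theta> * enorm d (\<lambda>j. s j + x j) = sqrt ((\<theta> * enorm d s)\<^sup>2 + 2 * p + (\<theta> * enorm d x)\<^sup>2)"
    using assms by (intro real_sqrt_unique[symmetric]) (auto intro!: mult_nonneg_nonneg enorm_nonneg)
  with le show ?thesis
    using assms by (simp add: p_def enorm_nonneg sum_distrib_left mult_ac)
qed

section \<open>Exponential moments from a conditional tail bound\<close>

text \<open>
  Used with \<open>s = \<theta> \<sigma>\<close> and \<open>z = \<parallel>X\<parallel> / \<sigma>\<close>, where \<open>\<sigma>\<close> is known and \<open>X\<close> is not: the right-hand side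
  separates the two, and its first-order term in \<open>s\<close> vanishes. The inequality is valid for all
  \<open>s\<close>, large ones included, so no case distinction on the random \<open>\<sigma>\<close> arises later.
\<close>

lemma exp_minus_le_subgaussian:
  fixes s z :: real
  assumes "0 \<le> s" "0 \<le> z"
  shows "exp (s * z) - s * z \<le> 1 + 8 * s\<^sup>2 * exp (2 * s\<^sup>2) * exp (z\<^sup>2 / 4)"
proof -
  define y where "y = s * z"
  have y: "0 \<le> y"
    using assms by (simp add: y_def)
  have "exp y * (1 - y) \<le> exp y * exp (- y)"
    using exp_ge_add_one_self[of "- y"] by (intro mult_left_mono) auto
  then have expm1: "exp y - 1 \<le> y * exp y"
    by (simp add: algebra_simps flip: exp_add)
  have "exp y - y - 1 \<le> y * (exp y - 1)"
    using expm1 by (simp add: algebra_simps)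
  also have "\<dots> \<le> y * (y * exp y)"
    using expm1 y by (rule mult_left_mono)
  finally have rem: "exp y - y - 1 \<le> y\<^sup>2 * exp y"
    by (simp add: power2_eq_square mult.assoc)
  \<comment> \<open>Half of the available exponent \<open>z\<^sup>2 / 4\<close> is spent on \<open>exp y\<close>, the other half on the factor
    \<open>z\<^sup>2\<close> of \<open>y\<^sup>2\<close>.\<close>
  have "0 \<le> 2 * (s - z / 4)\<^sup>2" by simp
  then have "y \<le> 2 * s\<^sup>2 + z\<^sup>2 / 8"
    by (simp add: y_def power2_eq_square algebra_simps)
  then have "exp y \<le> exp (2 * s\<^sup>2) * exp (z\<^sup>2 / 8)"
    by (simp flip: exp_add)
  moreover have "z\<^sup>2 \<le> 8 * exp (z\<^sup>2 / 8)"
    using exp_ge_add_one_self[of "z\<^sup>2 / 8"] by linarith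
  then have "y\<^sup>2 \<le> 8 * s\<^sup>2 * exp (z\<^sup>2 / 8)"
    using mult_left_mono[of "z\<^sup>2" "8 * exp (z\<^sup>2 / 8)" "s\<^sup>2"] by (simp add: y_def power_mult_distrib mult_ac)
  ultimately have "y\<^sup>2 * exp y \<le> (8 * s\<^sup>2 * exp (z\<^sup>2 / 8)) * (exp (2 * s\<^sup>2) * exp (z\<^sup>2 / 8))"
    by (intro mult_mono) auto
  also have "\<dots> = 8 * s\<^sup>2 * exp (2 * s\<^sup>2) * (exp (z\<^sup>2 / 8) * exp (z\<^sup>2 / 8))"
    by (simp add: mult_ac)
  also have "exp (z\<^sup>2 / 8) * exp (z\<^sup>2 / 8) = exp (z\<^sup>2 / 4)"
    by (simp flip: exp_add)
  finally show ?thesis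
    using rem by (simp add: y_def)
qed

text \<open>
  The left-hand side is the bound of the preceding lemma after \<open>exp (z\<^sup>2 / 4)\<close> has been
  replaced by the bound \<open>3\<close> on its expectation. This fixes the constant of the theorem.
\<close>

lemma one_plus_le_exp_26:
  fixes s :: real
  shows "1 + 3 * (8 * s\<^sup>2 * exp (2 * s\<^sup>2)) \<le> exp (26 * s\<^sup>2)"
proof -
  have "1 + 24 * s\<^sup>2 * exp (2 * s\<^sup>2) \<le> exp (2 * s\<^sup>2) + 24 * s\<^sup>2 * exp (2 * s\<^sup>2)"
    by simp
  also have "\<dots> = (1 + 24 * s\<^sup>2) * exp (2 * s\<^sup>2)"
    by (simp add: algebra_simps)
  also have "\<dots> \<le> exp (24 * s\<^sup>2) * exp (2 * s\<^sup>2)"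
    by (intro mult_right_mono exp_ge_add_one_self) auto
  finally show ?thesis
    by (simp flip: exp_add)
qed

lemma le_exp_minus:
  fixes y :: real
  assumes "0 \<le> y"
  shows "y \<le> exp y - y"
proof -
  have "y * 2 \<le> exp (y - 1) * exp 1"
    using exp_ge_add_one_self[of "y - 1"] exp_ge_add_one_self[of "1::real"] assms
    by (intro mult_mono) auto
  then show ?thesis
    by (simp flip: exp_add)
qed

text \<open>
  Layer-cake form: integrating over \<open>x\<close> turns the indicator of \<open>t \<le> x\<close> into a tail probability.
\<close>

lemma nn_integral_gaussian_layer:
  fixes x b :: real
  assumes "0 \<le> x"
  shows "ennreal (exp (x\<^sup>2 / (4 * b\<^sup>2))) = 1 + (\<integral>\<^sup>+t. ennreal (t / (2 * b\<^sup>2) * exp (t\<^sup>2 / (4 * b\<^sup>2))) * indicator {0..x} t \<partial>lborel)"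
proof (cases "b = 0")
  case False
  have "(\<integral>\<^sup>+t. ennreal (t / (2 * b\<^sup>2) * exp (t\<^sup>2 / (4 * b\<^sup>2))) * indicator {0..x} t \<partial>lborel)
     = exp (x\<^sup>2 / (4 * b\<^sup>2)) - exp (0\<^sup>2 / (4 * b\<^sup>2))"
    by (rule nn_integral_FTC_Icc) (use assms False in \<open>auto intro!: derivative_eq_intros simp: field_simps\<close>)
  then show ?thesis
    by (simp flip: ennreal_plus ennreal_1 add: ennreal_plus[symmetric])
qed auto

lemma nn_integral_gaussian_tail:
  fixes b :: real
  assumes "0 < b"
  shows "(\<integral>\<^sup>+t. ennreal (t / b\<^sup>2 * exp (- (t\<^sup>2 / (4 * b\<^sup>2)))) * indicator {0..} t \<partial>lborel) = 2"
proof -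
  have "filterlim (\<lambda>t. 1 / (4 * b\<^sup>2) * t\<^sup>2) at_top at_top"
    using assms
    by (intro filterlim_tendsto_pos_mult_at_top[OF tendsto_const] filterlim_pow_at_top filterlim_ident)
      auto
  then have "filterlim (\<lambda>t. - (t\<^sup>2 / (4 * b\<^sup>2))) at_bot at_top"
    by (simp add: filterlim_uminus_at_top[symmetric])
  then have "((\<lambda>t. - 2 * exp (- (t\<^sup>2 / (4 * b\<^sup>2)))) \<longlongrightarrow> - 2 * 0) at_top"
    by (intro tendsto_intros filterlim_compose[OF exp_at_bot])
  then have "(\<integral>\<^sup>+t. ennreal (t / b\<^sup>2 * exp (- (t\<^sup>2 / (4 * b\<^sup>2)))) * indicator {0..} t \<partial>lborel)
     = ennreal (- 2 * 0 - (- 2 * exp (- (0\<^sup>2 / (4 * b\<^sup>2)))))"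
    by (intro nn_integral_FTC_atLeast)
      (use assms in \<open>auto intro!: derivative_eq_intros simp: field_simps\<close>)
  then show ?thesis by simp
qed

text \<open>
  A bound on a conditional probability may be integrated against any nonnegative weight measurable
  with respect to the conditioning \<open>\<sigma>\<close>-algebra. The work lies in passing from the real-valued to
  the extended nonnegative conditional expectation, which agree because the latter is at most 1.
\<close>

lemma (in finite_measure_subalgebra) nn_integral_indicator_le_of_real_cond_exp_le:
  fixes g :: "'a \<Rightarrow> real"
  assumes A [measurable]: "A \<in> sets M"
    and v [measurable]: "v \<in> borel_measurable F"
    and le: "AE x in M. real_cond_exp M F (indicator A) x \<le> g x"
  shows "(\<integral>\<^sup>+x. v x * indicator A x \<partial>M) \<le> (\<integral>\<^sup>+x. v x * ennreal (g x) \<partial>M)"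
proof -
  have "(\<integral>\<^sup>+x. v x * indicator A x \<partial>M) = (\<integral>\<^sup>+x. v x * nn_cond_exp M F (indicator A) x \<partial>M)"
    by (rule nn_cond_exp_intg[symmetric]) auto
  also have "\<dots> \<le> (\<integral>\<^sup>+x. v x * ennreal (g x) \<partial>M)"
  proof (rule nn_integral_mono_AE)
    have "AE x in M. nn_cond_exp M F (\<lambda>_. 0) x = 0"
      using nn_cond_exp_F_meas[of "\<lambda>_. 0"] by auto
    moreover have "AE x in M. nn_cond_exp M F (\<lambda>_. 1) x = 1"
      using nn_cond_exp_F_meas[of "\<lambda>_. 1"] by auto
    moreover have "AE x in M. nn_cond_exp M F (indicator A) x \<le> nn_cond_exp M F (\<lambda>_. 1) x"
      by (rule nn_cond_exp_mono) (auto split: split_indicator)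
    ultimately show "AE x in M. v x * nn_cond_exp M F (indicator A) x \<le> v x * ennreal (g x)"
      using le
    proof eventually_elim
      case (elim x)
      let ?N = "nn_cond_exp M F (indicator A) x"
      have "(\<lambda>x. ennreal (indicator A x)) = (indicator A :: 'a \<Rightarrow> ennreal)"
        "(\<lambda>x. ennreal (- indicator A x)) = (\<lambda>_. 0)"
        by (auto simp: fun_eq_iff ennreal_neg split: split_indicator)
      then have "enn2real ?N \<le> g x"
        using elim by (simp add: real_cond_exp_def)
      moreover have "?N < top"
        using elim by (simp add: order_le_less_trans)
      ultimately have "?N \<le> ennreal (g x)"
        by (metis ennreal_enn2real ennreal_leI)
      then show ?case by (rule mult_left_mono) simp
    qed
  qed
  finally show ?thesis .
qed

text \<open>
  This says that \<open>exp (R\<^sup>2 / (4 b\<^sup>2))\<close> has conditional expectation at most \<open>3\<close>. The tail bound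
  holds almost surely for each level \<open>t\<close> separately; to integrate over \<open>t\<close> without choosing a
  regular conditional distribution, the conditional expectation is tested against a weight \<open>w\<close>,
  and Tonelli's theorem is applied to the unconditional integrals.
\<close>

lemma (in finite_measure_subalgebra) nn_integral_exp_square_le_of_subgaussian_tail:
  fixes R b :: "'a \<Rightarrow> real"
  assumes R [measurable]: "R \<in> borel_measurable M" and R_nonneg: "\<And>x. 0 \<le> R x"
    and b [measurable]: "b \<in> borel_measurable F" and b_pos: "\<And>x. x \<in> space M \<Longrightarrow> 0 < b x"
    and w [measurable]: "w \<in> borel_measurable F"
    and tail: "\<And>t. 0 \<le> t \<Longrightarrow> AE x in M. real_cond_exp M F (indicator {x \<in> space M. t \<le> R x}) x
        \<le> 2 * exp (- (t\<^sup>2 / (2 * (b x)\<^sup>2)))"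
  shows "(\<integral>\<^sup>+x. w x * ennreal (exp ((R x)\<^sup>2 / (4 * (b x)\<^sup>2))) \<partial>M) \<le> 3 * (\<integral>\<^sup>+x. w x \<partial>M)"
proof -
  have [measurable]: "b \<in> borel_measurable M" "w \<in> borel_measurable M"
    using b w by (auto intro: measurable_from_subalg[OF subalg])
  interpret P: pair_sigma_finite M lborel ..
  define k where "k t x = ennreal (t / (2 * (b x)\<^sup>2) * exp (t\<^sup>2 / (4 * (b x)\<^sup>2))) * indicator {0..} t"
    for t x
  have [measurable]: "(\<lambda>(x, t). k t x) \<in> borel_measurable (M \<Otimes>\<^sub>M lborel)"
    unfolding k_def by measurable
  have [measurable]: "k t \<in> borel_measurable F" for t
    unfolding k_def by measurable
  have layer: "ennreal (exp ((R x)\<^sup>2 / (4 * (b x)\<^sup>2)))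
      = 1 + (\<integral>\<^sup>+t. k t x * indicator {x \<in> space M. t \<le> R x} x \<partial>lborel)" if "x \<in> space M" for x
    unfolding nn_integral_gaussian_layer[OF R_nonneg]
    by (intro arg_cong2[where f="(+)"] nn_integral_cong)
      (use that in \<open>auto simp: k_def split: split_indicator\<close>)
  have tail_int: "(\<integral>\<^sup>+t. k t x * ennreal (2 * exp (- (t\<^sup>2 / (2 * (b x)\<^sup>2)))) \<partial>lborel) = 2"
    if "x \<in> space M" for x
  proof -
    have "k t x * ennreal (2 * exp (- (t\<^sup>2 / (2 * (b x)\<^sup>2))))
        = ennreal (t / (b x)\<^sup>2 * exp (- (t\<^sup>2 / (4 * (b x)\<^sup>2)))) * indicator {0..} t" for t
    proof (cases "0 \<le> t")
      case True
      have "t / (2 * (b x)\<^sup>2) * exp (t\<^sup>2 / (4 * (b x)\<^sup>2)) * (2 * exp (- (t\<^sup>2 / (2 * (b x)\<^sup>2))))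
          = t / (b x)\<^sup>2 * (exp (t\<^sup>2 / (4 * (b x)\<^sup>2)) * exp (- (t\<^sup>2 / (2 * (b x)\<^sup>2))))"
        by simp
      also have "exp (t\<^sup>2 / (4 * (b x)\<^sup>2)) * exp (- (t\<^sup>2 / (2 * (b x)\<^sup>2))) = exp (- (t\<^sup>2 / (4 * (b x)\<^sup>2)))"
        unfolding exp_add[symmetric] by (rule arg_cong[where f=exp]) (simp add: field_simps)
      finally show ?thesis
        using True by (simp add: k_def flip: ennreal_mult)
    qed (simp add: k_def)
    then show ?thesis
      using nn_integral_gaussian_tail[OF b_pos[OF that]] by simp
  qed
  have "(\<integral>\<^sup>+x. w x * ennreal (exp ((R x)\<^sup>2 / (4 * (b x)\<^sup>2))) \<partial>M)
      = (\<integral>\<^sup>+x. w x + (\<integral>\<^sup>+t. w x * k t x * indicator {x \<in> space M. t \<le> R x} x \<partial>lborel) \<partial>M)"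
    by (intro nn_integral_cong)
      (simp add: layer distrib_left mult.assoc nn_integral_cmult)
  also have "\<dots> = (\<integral>\<^sup>+x. w x \<partial>M)
      + (\<integral>\<^sup>+x. (\<integral>\<^sup>+t. w x * k t x * indicator {x \<in> space M. t \<le> R x} x \<partial>lborel) \<partial>M)"
    by (rule nn_integral_add) measurable
  also have "(\<integral>\<^sup>+x. (\<integral>\<^sup>+t. w x * k t x * indicator {x \<in> space M. t \<le> R x} x \<partial>lborel) \<partial>M)
      = (\<integral>\<^sup>+t. (\<integral>\<^sup>+x. w x * k t x * indicator {x \<in> space M. t \<le> R x} x \<partial>M) \<partial>lborel)"
    by (rule P.Fubini'[symmetric]) measurable
  also have "\<dots> \<le> (\<integral>\<^sup>+t. (\<integral>\<^sup>+x. w x * k t x * ennreal (2 * exp (- (t\<^sup>2 / (2 * (b x)\<^sup>2)))) \<partial>M) \<partial>lborel)"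
  proof (rule nn_integral_mono)
    fix t :: real
    show "(\<integral>\<^sup>+x. w x * k t x * indicator {x \<in> space M. t \<le> R x} x \<partial>M)
        \<le> (\<integral>\<^sup>+x. w x * k t x * ennreal (2 * exp (- (t\<^sup>2 / (2 * (b x)\<^sup>2)))) \<partial>M)"
    proof (cases "0 \<le> t")
      case True
      then show ?thesis
        by (intro nn_integral_indicator_le_of_real_cond_exp_le tail) measurable
    qed (simp add: k_def)
  qed
  also have "\<dots> = (\<integral>\<^sup>+x. (\<integral>\<^sup>+t. w x * k t x * ennreal (2 * exp (- (t\<^sup>2 / (2 * (b x)\<^sup>2)))) \<partial>lborel) \<partial>M)"
    by (rule P.Fubini') measurable
  also have "\<dots> = (\<integral>\<^sup>+x. w x * 2 \<partial>M)"
    by (intro nn_integral_cong) (simp add: mult.assoc nn_integral_cmult tail_int)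
  also have "\<dots> = 2 * (\<integral>\<^sup>+x. w x \<partial>M)"
    by (subst nn_integral_multc) (simp_all add: mult.commute)
  finally have "(\<integral>\<^sup>+x. w x * ennreal (exp ((R x)\<^sup>2 / (4 * (b x)\<^sup>2))) \<partial>M)
      \<le> (\<integral>\<^sup>+x. w x \<partial>M) + 2 * (\<integral>\<^sup>+x. w x \<partial>M)"
    by (simp add: add_left_mono)
  also have "\<dots> = (1 + 2) * (\<integral>\<^sup>+x. w x \<partial>M)"
    unfolding distrib_right by simp
  finally show ?thesis by simp
qed

section \<open>The supermartingale\<close>

text \<open>
  One step of the supermartingale: \<open>S\<close> is the sum so far, \<open>X\<close> the next increment and \<open>w\<close> the
  exponential weight so far. The delicate point is that the term linear in \<open>X\<close> must be integrable
  before it can be said to vanish, although \<open>S\<close>, \<open>X\<close> and \<open>b\<close> may all be unbounded. It is, because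
  it is dominated by the main term \<open>P\<close>, whose integral is at most the finite one of the previous
  step.
\<close>

lemma (in finite_measure_subalgebra) nn_integral_cosh_enorm_step_le:
  fixes S X :: "'a \<Rightarrow> nat \<Rightarrow> real" and b w :: "'a \<Rightarrow> real"
  assumes S: "\<And>j. j < d \<Longrightarrow> (\<lambda>x. S x j) \<in> borel_measurable F"
    and X: "\<And>j. j < d \<Longrightarrow> (\<lambda>x. X x j) \<in> borel_measurable M"
    and b: "b \<in> borel_measurable F" and b_pos: "\<And>x. x \<in> space M \<Longrightarrow> 0 < b x"
    and w: "w \<in> borel_measurable F" and w_nonneg: "\<And>x. 0 \<le> w x"
    and "0 < \<theta>"
    and mean: "\<And>j. j < d \<Longrightarrow> AE x in M. real_cond_exp M F (\<lambda>x. X x j) x = 0"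
    and tail: "\<And>t. 0 \<le> t \<Longrightarrow> AE x in M.
        real_cond_exp M F (indicator {x \<in> space M. t \<le> enorm d (X x)}) x
        \<le> 2 * exp (- (t\<^sup>2 / (2 * (b x)\<^sup>2)))"
    and fin: "(\<integral>\<^sup>+x. ennreal (w x * cosh (\<theta> * enorm d (S x))) \<partial>M) < \<infinity>"
  shows "(\<integral>\<^sup>+x. ennreal (w x * exp (- (26 * \<theta>\<^sup>2 * (b x)\<^sup>2))
              * cosh (\<theta> * enorm d (\<lambda>j. S x j + X x j))) \<partial>M)
      \<le> (\<integral>\<^sup>+x. ennreal (w x * cosh (\<theta> * enorm d (S x))) \<partial>M)"
    (is "?lhs \<le> ?rhs")
proof -
  define D where "D x = w x * exp (- (26 * \<theta>\<^sup>2 * (b x)\<^sup>2))" for x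
  define a where "a x = \<theta> * enorm d (S x)" for x
  define y where "y x = \<theta> * enorm d (X x)" for x
  define B where "B x = 8 * (\<theta> * b x)\<^sup>2 * exp (2 * (\<theta> * b x)\<^sup>2)" for x
  define P where "P x = D x * cosh (a x) * (exp (y x) - y x)" for x
  \<comment> \<open>Where \<open>a x = 0\<close> the quotient is \<open>0\<close>, which is harmless since \<open>S x\<close> vanishes there.\<close>
  define g where "g j x = D x * (sinh (a x) / a x * \<theta>\<^sup>2 * S x j)" for j x
  have F_meas: "a \<in> borel_measurable F" "D \<in> borel_measurable F" "B \<in> borel_measurable F"
    unfolding a_def D_def B_def using borel_measurable_enorm[OF S] b w by measurable
  note [measurable] = b w F_meas
  have g_meas: "g j \<in> borel_measurable F" if "j < d" for j
    unfolding g_def using S[OF that] by measurable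
  have enorm_X [measurable]: "(\<lambda>x. enorm d (X x)) \<in> borel_measurable M"
    using borel_measurable_enorm[OF X] .
  have [measurable]: "y \<in> borel_measurable M"
    unfolding y_def by measurable
  note [measurable] = F_meas[THEN measurable_from_subalg[OF subalg]]
  have [measurable]: "b \<in> borel_measurable M"
    by (rule measurable_from_subalg[OF subalg b])
  have [measurable]: "P \<in> borel_measurable M"
    unfolding P_def by measurable
  have a_nonneg: "0 \<le> a x" and y_nonneg: "0 \<le> y x" and D_nonneg: "0 \<le> D x" for x
    using \<open>0 < \<theta>\<close> w_nonneg by (auto simp: a_def y_def D_def enorm_nonneg)
  have B_nonneg: "0 \<le> B x" for x
    by (simp add: B_def)
  have y_le: "y x \<le> exp (y x) - y x" for x
    by (rule le_exp_minus[OF y_nonneg])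
  have P_nonneg: "0 \<le> P x" for x
    unfolding P_def using y_le[of x] y_nonneg[of x] D_nonneg[of x] by (intro mult_nonneg_nonneg) auto

  have "(\<integral>\<^sup>+x. ennreal (P x) \<partial>M)
      \<le> (\<integral>\<^sup>+x. ennreal (D x * cosh (a x))
            + ennreal (D x * cosh (a x) * B x) * ennreal (exp ((enorm d (X x))\<^sup>2 / (4 * (b x)\<^sup>2))) \<partial>M)"
  proof (rule nn_integral_mono)
    fix x assume x: "x \<in> space M"
    have "exp (y x) - y x \<le> 1 + B x * exp ((enorm d (X x))\<^sup>2 / (4 * (b x)\<^sup>2))"
      using exp_minus_le_subgaussian[of "\<theta> * b x" "enorm d (X x) / b x"] \<open>0 < \<theta>\<close> b_pos[OF x]
      by (simp add: y_def B_def enorm_nonneg power_divide power_mult_distrib mult.commute)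
    then have "P x \<le> D x * cosh (a x) * (1 + B x * exp ((enorm d (X x))\<^sup>2 / (4 * (b x)\<^sup>2)))"
      unfolding P_def by (intro mult_left_mono) (auto simp: D_nonneg)
    then show "ennreal (P x) \<le> ennreal (D x * cosh (a x))
        + ennreal (D x * cosh (a x) * B x) * ennreal (exp ((enorm d (X x))\<^sup>2 / (4 * (b x)\<^sup>2)))"
      by (simp add: D_nonneg B_nonneg ennreal_leI distrib_left mult.assoc flip: ennreal_mult ennreal_plus)
  qed
  also have "\<dots> = (\<integral>\<^sup>+x. ennreal (D x * cosh (a x)) \<partial>M)
      + (\<integral>\<^sup>+x. ennreal (D x * cosh (a x) * B x) * ennreal (exp ((enorm d (X x))\<^sup>2 / (4 * (b x)\<^sup>2))) \<partial>M)"
    by (rule nn_integral_add) measurable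
  also have "\<dots> \<le> (\<integral>\<^sup>+x. ennreal (D x * cosh (a x)) \<partial>M)
      + 3 * (\<integral>\<^sup>+x. ennreal (D x * cosh (a x) * B x) \<partial>M)"
    by (intro add_left_mono nn_integral_exp_square_le_of_subgaussian_tail tail b_pos)
      (auto simp: enorm_nonneg)
  also have "\<dots> = (\<integral>\<^sup>+x. ennreal (D x * cosh (a x)) + 3 * ennreal (D x * cosh (a x) * B x) \<partial>M)"
    by (subst nn_integral_add) (auto simp: nn_integral_cmult)
  also have "\<dots> \<le> ?rhs"
  proof (rule nn_integral_mono)
    fix x
    have "D x * (1 + 3 * B x) \<le> D x * exp (26 * (\<theta> * b x)\<^sup>2)"
      unfolding B_def by (intro mult_left_mono one_plus_le_exp_26 D_nonneg)
    also have "\<dots> = w x"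
      by (simp add: D_def power_mult_distrib mult.assoc flip: exp_add)
    finally have "D x * (1 + 3 * B x) * cosh (a x) \<le> w x * cosh (a x)"
      by (rule mult_right_mono) simp
    then have "ennreal (D x * cosh (a x) + 3 * (D x * cosh (a x) * B x)) \<le> ennreal (w x * cosh (a x))"
      by (intro ennreal_leI) (simp add: algebra_simps)
    then show "ennreal (D x * cosh (a x)) + 3 * ennreal (D x * cosh (a x) * B x)
        \<le> ennreal (w x * cosh (\<theta> * enorm d (S x)))"
      by (simp add: D_nonneg B_nonneg ennreal_mult a_def)
  qed
  finally have P_le: "(\<integral>\<^sup>+x. ennreal (P x) \<partial>M) \<le> ?rhs" .
  have P_int: "integrable M P"
    by (rule integrableI_nonneg) (use P_nonneg P_le fin in auto)

  have lin_int: "integrable M (\<lambda>x. g j x * X x j)" and lin_zero: "(\<integral>x. g j x * X x j \<partial>M) = 0"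
    if j: "j < d" for j
  proof -
    have [measurable]: "g j \<in> borel_measurable F" "(\<lambda>x. X x j) \<in> borel_measurable M"
      using g_meas X j by auto
    have [measurable]: "g j \<in> borel_measurable M"
      by (rule measurable_from_subalg[OF subalg]) fact
    show int: "integrable M (\<lambda>x. g j x * X x j)"
    proof (rule Bochner_Integration.integrable_bound[OF P_int])
      show "AE x in M. norm (g j x * X x j) \<le> norm (P x)"
      proof (rule AE_I2)
        fix x
        have "\<theta> * \<bar>S x j\<bar> \<le> a x" "\<theta> * \<bar>X x j\<bar> \<le> y x"
          using \<open>0 < \<theta>\<close> abs_le_enorm[OF j] by (auto simp: a_def y_def)
        then have "\<bar>sinh (a x) / a x\<bar> * (\<theta> * \<bar>S x j\<bar>) * (\<theta> * \<bar>X x j\<bar>)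
            \<le> \<bar>sinh (a x) / a x\<bar> * a x * y x"
          using \<open>0 < \<theta>\<close> a_nonneg y_nonneg by (intro mult_mono mult_nonneg_nonneg) auto
        also have "\<bar>sinh (a x) / a x\<bar> * a x = sinh (a x)"
          using a_nonneg[of x] by (cases "a x = 0") (auto simp: abs_divide)
        also have "sinh (a x) * y x \<le> cosh (a x) * (exp (y x) - y x)"
          using y_le y_nonneg sinh_le_cosh_real by (intro mult_mono) auto
        finally have "D x * (\<bar>sinh (a x) / a x\<bar> * (\<theta> * \<bar>S x j\<bar>) * (\<theta> * \<bar>X x j\<bar>)) \<le> P x"
          unfolding P_def mult.assoc using D_nonneg by (intro mult_left_mono) (auto simp: mult.assoc)
        moreover have "norm (g j x * X x j)
            = D x * (\<bar>sinh (a x) / a x\<bar> * (\<theta> * \<bar>S x j\<bar>) * (\<theta> * \<bar>X x j\<bar>))"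
          using D_nonneg[of x] \<open>0 < \<theta>\<close> by (simp add: g_def abs_mult power2_eq_square)
        ultimately show "norm (g j x * X x j) \<le> norm (P x)"
          by simp
      qed
    qed measurable
    have "(\<integral>x. g j x * X x j \<partial>M) = (\<integral>x. g j x * real_cond_exp M F (\<lambda>x. X x j) x \<partial>M)"
      by (rule real_cond_exp_intg(2)[symmetric]) (use int in auto)
    also have "\<dots> = (\<integral>x. 0 \<partial>M)"
      by (rule integral_cong_AE) (use mean[OF j] in auto)
    finally show "(\<integral>x. g j x * X x j \<partial>M) = 0" by simp
  qed

  define Q where "Q x = P x + (\<Sum>j<d. g j x * X x j)" for x
  have Q_int: "integrable M Q"
    unfolding Q_def using P_int lin_int
    by (intro Bochner_Integration.integrable_add Bochner_Integration.integrable_sum) auto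
  have le_Q: "w x * exp (- (26 * \<theta>\<^sup>2 * (b x)\<^sup>2)) * cosh (\<theta> * enorm d (\<lambda>j. S x j + X x j)) \<le> Q x" for x
  proof -
    have "D x * cosh (\<theta> * enorm d (\<lambda>j. S x j + X x j))
        \<le> D x * (cosh (a x) * (exp (y x) - y x) + (\<Sum>j<d. sinh (a x) / a x * \<theta>\<^sup>2 * S x j * X x j))"
      unfolding a_def y_def by (intro mult_left_mono cosh_enorm_add_le \<open>0 < \<theta>\<close> D_nonneg)
    also have "\<dots> = Q x"
      unfolding Q_def P_def g_def distrib_left sum_distrib_left by (simp add: mult.assoc)
    finally show ?thesis
      by (simp add: D_def)
  qed
  then have "?lhs \<le> (\<integral>\<^sup>+x. ennreal (Q x) \<partial>M)"
    by (intro nn_integral_mono ennreal_leI)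
  also have "\<dots> = ennreal (\<integral>x. Q x \<partial>M)"
  proof (rule nn_integral_eq_integral[OF Q_int])
    have "0 \<le> Q x" for x
      by (rule order_trans[OF _ le_Q]) (simp add: w_nonneg)
    then show "AE x in M. 0 \<le> Q x" by simp
  qed
  also have "(\<integral>x. Q x \<partial>M) = (\<integral>x. P x \<partial>M) + (\<integral>x. (\<Sum>j<d. g j x * X x j) \<partial>M)"
    unfolding Q_def using P_int lin_int
    by (intro Bochner_Integration.integral_add Bochner_Integration.integrable_sum) auto
  also have "(\<integral>x. (\<Sum>j<d. g j x * X x j) \<partial>M) = (\<Sum>j<d. \<integral>x. g j x * X x j \<partial>M)"
    using lin_int by (intro Bochner_Integration.integral_sum) auto
  also have "\<dots> = 0"
    using lin_zero by simp
  also have "ennreal ((\<integral>x. P x \<partial>M) + 0) = (\<integral>\<^sup>+x. ennreal (P x) \<partial>M)"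
    by (simp add: nn_integral_eq_integral[OF P_int] P_nonneg)
  finally show ?thesis
    using P_le by order
qed

lemma measurable_Rd_component:
  assumes "f \<in> M \<rightarrow>\<^sub>M Rd d" "j < d"
  shows "(\<lambda>\<omega>. f \<omega> j) \<in> borel_measurable M"
  using measurable_compose[OF assms(1)[unfolded Rd_def] measurable_component_singleton] assms(2) by simp

lemma space_history [simp]: "space (history M d X i) = space M"
  by (simp add: history_def space_measure_of_conv)

lemma sets_history:
  "sets (history M d X i)
    = sigma_sets (space M) (\<Union>k\<in>{1..i}. {X k -` B \<inter> space M | B. B \<in> sets (Rd d)})"
  unfolding history_def by (rule sets_measure_of) auto

lemma subalgebra_history:
  assumes "\<And>k. k \<in> {1..i} \<Longrightarrow> X k \<in> M \<rightarrow>\<^sub>M Rd d"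
  shows "subalgebra M (history M d X i)"
  unfolding subalgebra_def
proof
  show "sets (history M d X i) \<subseteq> sets M"
    unfolding sets_history using assms by (intro sets.sigma_sets_subset) (auto intro: measurable_sets)
qed simp

lemma sets_history_mono: "i \<le> k \<Longrightarrow> sets (history M d X i) \<subseteq> sets (history M d X k)"
  unfolding sets_history by (intro sigma_sets_mono' UN_mono) auto

lemma measurable_history_mono:
  assumes "f \<in> history M d X i \<rightarrow>\<^sub>M N" "i \<le> k"
  shows "f \<in> history M d X k \<rightarrow>\<^sub>M N"
  using assms sets_history_mono[OF assms(2), of M d X] by (auto simp: measurable_def)

lemma measurable_history:
  assumes "X k \<in> M \<rightarrow>\<^sub>M Rd d" "k \<in> {1..i}"
  shows "X k \<in> history M d X i \<rightarrow>\<^sub>M Rd d"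
proof (rule measurableI)
  fix A assume "A \<in> sets (Rd d)"
  then show "X k -` A \<inter> space (history M d X i) \<in> sets (history M d X i)"
    unfolding sets_history by (intro sigma_sets.Basic UN_I[OF assms(2)]) auto
qed (use measurable_space[OF assms(1)] in auto)

lemma norm_subgaussian_mdsD:
  assumes "norm_subgaussian_mds M d n X \<sigma>" "i \<in> {1..n}"
  shows "X i \<in> M \<rightarrow>\<^sub>M Rd d"
    and "\<sigma> i \<in> borel_measurable (history M d X (i - 1))"
    and "\<And>\<omega>. \<omega> \<in> space M \<Longrightarrow> 0 < \<sigma> i \<omega>"
    and "\<And>j. j < d \<Longrightarrow> AE \<omega> in M. real_cond_exp M (history M d X (i - 1)) (\<lambda>\<omega>. X i \<omega> j) \<omega> = 0"
    and "\<And>t. 0 \<le> t \<Longrightarrow> AE \<omega> in M.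
           real_cond_exp M (history M d X (i - 1))
             (indicator {\<omega> \<in> space M. t \<le> enorm d (X i \<omega>)}) \<omega>
           \<le> 2 * exp (- (t\<^sup>2 / (2 * (\<sigma> i \<omega>)\<^sup>2)))"
  using assms unfolding norm_subgaussian_mds_def by auto

lemma norm_subgaussian_mds_subalgebra:
  assumes "norm_subgaussian_mds M d n X \<sigma>" "i \<le> n"
  shows "subalgebra M (history M d X i)"
  using norm_subgaussian_mdsD(1)[OF assms(1)] assms(2) by (intro subalgebra_history) auto

lemma norm_subgaussian_mds_measurable:
  assumes "norm_subgaussian_mds M d n X \<sigma>" "i \<in> {1..n}"
  shows "\<sigma> i \<in> borel_measurable M"
  using assms by (intro measurable_from_subalg[OF _ norm_subgaussian_mdsD(2)[OF assms]]
      norm_subgaussian_mds_subalgebra[OF assms(1)]) auto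

lemma partial_sum_measurable_history:
  assumes "norm_subgaussian_mds M d n X \<sigma>" "i \<le> n" "j < d"
  shows "(\<lambda>\<omega>. \<Sum>k\<in>{1..i}. X k \<omega> j) \<in> borel_measurable (history M d X i)"
proof (rule borel_measurable_sum)
  fix k assume k: "k \<in> {1..i}"
  then have "X k \<in> history M d X i \<rightarrow>\<^sub>M Rd d"
    using assms(2) by (intro measurable_history norm_subgaussian_mdsD(1)[OF assms(1)]) auto
  then show "(\<lambda>\<omega>. X k \<omega> j) \<in> borel_measurable (history M d X i)"
    by (rule measurable_Rd_component[OF _ assms(3)])
qed

lemma norm_sum_measurable:
  assumes "norm_subgaussian_mds M d n X \<sigma>" "i \<le> n"
  shows "(\<lambda>\<omega>. enorm d (\<lambda>j. \<Sum>k\<in>{1..i}. X k \<omega> j)) \<in> borel_measurable M"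
  by (intro borel_measurable_enorm measurable_from_subalg[OF norm_subgaussian_mds_subalgebra[OF assms]]
      partial_sum_measurable_history[OF assms])

lemma variance_sum_measurable:
  assumes "norm_subgaussian_mds M d n X \<sigma>"
  shows "(\<lambda>\<omega>. \<Sum>k\<in>{1..n}. (\<sigma> k \<omega>)\<^sup>2) \<in> borel_measurable M"
  using norm_subgaussian_mds_measurable[OF assms] by (intro borel_measurable_sum borel_measurable_power)

text \<open>
  The expectation of the supermartingale. Keeping it at most 1 along the induction also supplies the
  finiteness that each step requires.
\<close>

lemma nn_integral_cosh_enorm_sum_le_1:
  assumes "prob_space M" and mds: "norm_subgaussian_mds M d n X \<sigma>" and "0 < \<theta>" and "i \<le> n"
  shows "(\<integral>\<^sup>+\<omega>. ennreal (exp (- (26 * \<theta>\<^sup>2 * (\<Sum>k\<in>{1..i}. (\<sigma> k \<omega>)\<^sup>2)))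
           * cosh (\<theta> * enorm d (\<lambda>j. \<Sum>k\<in>{1..i}. X k \<omega> j))) \<partial>M) \<le> 1"
  using \<open>i \<le> n\<close>
proof (induction i)
  case 0
  interpret prob_space M by fact
  show ?case by (simp add: enorm_def L2_set_def emeasure_space_1)
next
  case (Suc i)
  interpret prob_space M by fact
  interpret finite_measure_subalgebra M "history M d X i"
    by unfold_locales (rule norm_subgaussian_mds_subalgebra[OF mds], use Suc in simp)
  define w where "w \<omega> = exp (- (26 * \<theta>\<^sup>2 * (\<Sum>k\<in>{1..i}. (\<sigma> k \<omega>)\<^sup>2)))" for \<omega>
  define S where "S \<omega> j = (\<Sum>k\<in>{1..i}. X k \<omega> j)" for \<omega> j
  have IH: "(\<integral>\<^sup>+\<omega>. ennreal (w \<omega> * cosh (\<theta> * enorm d (S \<omega>))) \<partial>M) \<le> 1"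
    using Suc unfolding w_def S_def by simp
  have Suc_i: "Suc i \<in> {1..n}" using Suc by simp
  note X = norm_subgaussian_mdsD[OF mds Suc_i, simplified]
  have \<sigma>: "\<sigma> k \<in> borel_measurable (history M d X i)" if "k \<in> {1..i}" for k
    by (rule measurable_history_mono[OF norm_subgaussian_mdsD(2)[OF mds]]) (use that Suc in auto)
  have w: "w \<in> borel_measurable (history M d X i)"
    unfolding w_def using \<sigma> by measurable
  have "(\<integral>\<^sup>+\<omega>. ennreal (w \<omega> * exp (- (26 * \<theta>\<^sup>2 * (\<sigma> (Suc i) \<omega>)\<^sup>2))
          * cosh (\<theta> * enorm d (\<lambda>j. S \<omega> j + X (Suc i) \<omega> j))) \<partial>M)
      \<le> (\<integral>\<^sup>+\<omega>. ennreal (w \<omega> * cosh (\<theta> * enorm d (S \<omega>))) \<partial>M)"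
  proof (rule nn_integral_cosh_enorm_step_le[OF _ _ X(2) X(3) w _ \<open>0 < \<theta>\<close> X(4) X(5)])
    show "(\<lambda>\<omega>. S \<omega> j) \<in> borel_measurable (history M d X i)" if "j < d" for j
      unfolding S_def using Suc that by (intro partial_sum_measurable_history[OF mds]) auto
    show "(\<lambda>\<omega>. X (Suc i) \<omega> j) \<in> borel_measurable M" if "j < d" for j
      by (rule measurable_Rd_component[OF X(1) that])
    show "(\<integral>\<^sup>+\<omega>. ennreal (w \<omega> * cosh (\<theta> * enorm d (S \<omega>))) \<partial>M) < \<infinity>"
      using IH by (simp add: order_le_less_trans)
  qed (auto simp: w_def)
  also note IH
  finally show ?case
    by (simp add: w_def S_def distrib_left flip: exp_add)
qed

lemma norm_sum_bound_26: "norm_sum_bound TYPE('a) 26"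
  unfolding norm_sum_bound_def
proof (intro allI impI)
  fix M :: "'a measure" and d n :: nat and X :: "nat \<Rightarrow> 'a \<Rightarrow> nat \<Rightarrow> real" and \<sigma> :: "nat \<Rightarrow> 'a \<Rightarrow> real"
    and \<delta> \<theta> :: real
  assume M: "prob_space M" and "1 \<le> d" and "1 \<le> n" and mds: "norm_subgaussian_mds M d n X \<sigma>"
    and \<delta>: "0 < \<delta>" and \<theta>: "0 < \<theta>"
  interpret prob_space M by fact
  define V where "V \<omega> = (\<Sum>i\<in>{1..n}. (\<sigma> i \<omega>)\<^sup>2)" for \<omega>
  define R where "R \<omega> = enorm d (\<lambda>j. \<Sum>i\<in>{1..n}. X i \<omega> j)" for \<omega>
  define Z where "Z \<omega> = exp (- (26 * \<theta>\<^sup>2 * V \<omega>)) * cosh (\<theta> * R \<omega>)" for \<omega>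
  define G where "G = {\<omega> \<in> space M. R \<omega> \<le> 26 * (\<theta> * V \<omega>) + 1 / \<theta> * ln (2 * real d / \<delta>)}"
  have [measurable]: "R \<in> borel_measurable M" "V \<in> borel_measurable M"
    unfolding R_def V_def using norm_sum_measurable[OF mds] variance_sum_measurable[OF mds] by auto
  have [measurable]: "Z \<in> borel_measurable M"
    unfolding Z_def by measurable
  have [measurable]: "G \<in> sets M"
    unfolding G_def by measurable
  \<comment> \<open>Outside \<open>G\<close> already the smaller, dimension-free bound with \<open>ln (2 / \<delta>)\<close> is violated.\<close>
  have "1 \<le> \<delta> * Z \<omega>" if "\<omega> \<in> space M - G" for \<omega>
  proof -
    have "26 * (\<theta> * V \<omega>) + 1 / \<theta> * ln (2 * real d / \<delta>) < R \<omega>"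
      using that by (auto simp: G_def)
    then have "\<theta> * (26 * (\<theta> * V \<omega>) + 1 / \<theta> * ln (2 * real d / \<delta>)) < \<theta> * R \<omega>"
      using \<theta> by simp
    then have "26 * \<theta>\<^sup>2 * V \<omega> + ln (2 * real d / \<delta>) < \<theta> * R \<omega>"
      using \<theta> by (simp add: distrib_left power2_eq_square mult_ac)
    moreover have "ln (2 / \<delta>) \<le> ln (2 * real d / \<delta>)"
      using \<open>1 \<le> d\<close> \<delta> by (simp add: divide_right_mono)
    ultimately have "ln (2 / \<delta>) \<le> - (26 * \<theta>\<^sup>2 * V \<omega>) + \<theta> * R \<omega>"
      by linarith
    then have "exp (ln (2 / \<delta>)) \<le> exp (- (26 * \<theta>\<^sup>2 * V \<omega>) + \<theta> * R \<omega>)"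
      by simp
    then have "2 / \<delta> \<le> exp (- (26 * \<theta>\<^sup>2 * V \<omega>) + \<theta> * R \<omega>)"
      using \<delta> by simp
    also have "\<dots> = exp (- (26 * \<theta>\<^sup>2 * V \<omega>)) * exp (\<theta> * R \<omega>)"
      by (rule exp_add)
    also have "\<dots> \<le> exp (- (26 * \<theta>\<^sup>2 * V \<omega>)) * (2 * cosh (\<theta> * R \<omega>))"
      by (intro mult_left_mono) (auto simp: cosh_def)
    finally show ?thesis
      using \<delta> by (simp add: Z_def field_simps)
  qed
  then have "space M - G \<subseteq> {\<omega> \<in> space M. 1 \<le> ennreal \<delta> * ennreal (Z \<omega>)}"
    using \<delta> by (auto simp: Z_def simp flip: ennreal_mult ennreal_1)
  then have "emeasure M (space M - G) \<le> emeasure M {\<omega> \<in> space M. 1 \<le> ennreal \<delta> * ennreal (Z \<omega>)}"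
    by (rule emeasure_mono) measurable
  also have "\<dots> \<le> ennreal \<delta> * (\<integral>\<^sup>+\<omega>. ennreal (Z \<omega>) * indicator (space M) \<omega> \<partial>M)"
    by (rule nn_integral_Markov_inequality) auto
  also have "(\<integral>\<^sup>+\<omega>. ennreal (Z \<omega>) * indicator (space M) \<omega> \<partial>M) = (\<integral>\<^sup>+\<omega>. ennreal (Z \<omega>) \<partial>M)"
    by (rule nn_integral_cong) auto
  also have "ennreal \<delta> * (\<integral>\<^sup>+\<omega>. ennreal (Z \<omega>) \<partial>M) \<le> ennreal \<delta> * 1"
    using nn_integral_cosh_enorm_sum_le_1[OF M mds \<theta> order_refl]
    unfolding Z_def V_def R_def by (rule mult_left_mono) simp
  finally have "prob (space M - G) \<le> \<delta>"
    using \<delta> by (simp add: emeasure_eq_measure)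
  then have "1 - \<delta> \<le> prob G"
    using prob_compl[of G] by simp
  then show "1 - \<delta> \<le> prob {\<omega> \<in> space M. enorm d (\<lambda>j. \<Sum>i\<in>{1..n}. X i \<omega> j)
      \<le> 26 * (\<theta> * (\<Sum>i\<in>{1..n}. (\<sigma> i \<omega>)\<^sup>2)) + 1 / \<theta> * ln (2 * real d / \<delta>)}"
    by (simp add: G_def R_def V_def)
qed

section \<open>Transport to the canonical sample space\<close>

text \<open>
  Conditional expectation commutes with taking image measures, as its defining property is an
  equality of integrals. The version for extended nonnegative functions comes first because it needs
  no integrability, which the coordinates of the vectors are not known to have.
\<close>

lemma nn_cond_exp_distr:
  fixes T :: "'a \<Rightarrow> 'b"
  assumes T [measurable]: "T \<in> M \<rightarrow>\<^sub>M N"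
    and F: "finite_measure_subalgebra M F" and F': "finite_measure_subalgebra (distr M N T) F'"
    and sets_F: "sets F = {T -` A \<inter> space M | A. A \<in> sets F'}"
    and f [measurable]: "f \<in> borel_measurable N"
    and h [measurable]: "h \<in> borel_measurable M" and hf: "\<And>x. x \<in> space M \<Longrightarrow> h x = f (T x)"
  shows "AE x in M. nn_cond_exp M F h x = nn_cond_exp (distr M N T) F' f (T x)"
proof -
  interpret F: finite_measure_subalgebra M F by fact
  interpret F': finite_measure_subalgebra "distr M N T" F' by fact
  have space_F: "space F = space M" "space F' = space N"
    using F.subalg F'.subalg by (auto simp: subalgebra_def)
  have "T \<in> F \<rightarrow>\<^sub>M F'"
    by (rule measurableI) (use measurable_space[OF T] sets_F in \<open>auto simp: space_F\<close>)
  then have "(\<lambda>x. nn_cond_exp (distr M N T) F' f (T x)) \<in> borel_measurable F"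
    by (rule measurable_compose) simp
  moreover have "(\<integral>\<^sup>+x\<in>A. h x \<partial>M) = (\<integral>\<^sup>+x\<in>A. nn_cond_exp (distr M N T) F' f (T x) \<partial>M)"
    if "A \<in> sets F" for A
  proof -
    have "\<exists>B. A = T -` B \<inter> space M \<and> B \<in> sets F'"
      using that unfolding sets_F by (rule CollectD)
    then obtain B where A: "A = T -` B \<inter> space M" and B [measurable]: "B \<in> sets F'"
      by auto
    have [measurable]: "B \<in> sets N"
      using B F'.subalg by (auto simp: subalgebra_def)
    have "(\<integral>\<^sup>+x\<in>A. h x \<partial>M) = (\<integral>\<^sup>+x. indicator B (T x) * f (T x) \<partial>M)"
      by (rule nn_integral_cong) (auto simp: A hf split: split_indicator)
    also have "\<dots> = (\<integral>\<^sup>+y. indicator B y * f y \<partial>distr M N T)"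
      by (rule nn_integral_distr[symmetric]) measurable
    also have "\<dots> = (\<integral>\<^sup>+y. indicator B y * nn_cond_exp (distr M N T) F' f y \<partial>distr M N T)"
      by (rule F'.nn_cond_exp_intg[symmetric]) auto
    also have "\<dots> = (\<integral>\<^sup>+x. indicator B (T x) * nn_cond_exp (distr M N T) F' f (T x) \<partial>M)"
      by (rule nn_integral_distr) measurable
    also have "\<dots> = (\<integral>\<^sup>+x\<in>A. nn_cond_exp (distr M N T) F' f (T x) \<partial>M)"
      by (rule nn_integral_cong) (auto simp: A split: split_indicator)
    finally show ?thesis .
  qed
  ultimately have "AE x in M. nn_cond_exp (distr M N T) F' f (T x) = nn_cond_exp M F h x"
    by (intro F.nn_cond_exp_charact[OF _ h])
  then show ?thesis
    by eventually_elim (rule sym)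
qed

lemma real_cond_exp_distr:
  fixes T :: "'a \<Rightarrow> 'b" and f :: "'b \<Rightarrow> real"
  assumes T: "T \<in> M \<rightarrow>\<^sub>M N"
    and F: "finite_measure_subalgebra M F" and F': "finite_measure_subalgebra (distr M N T) F'"
    and sets_F: "sets F = {T -` A \<inter> space M | A. A \<in> sets F'}"
    and f [measurable]: "f \<in> borel_measurable N"
    and h [measurable]: "h \<in> borel_measurable M" and hf: "\<And>x. x \<in> space M \<Longrightarrow> h x = f (T x)"
  shows "AE x in M. real_cond_exp M F h x = real_cond_exp (distr M N T) F' f (T x)"
proof -
  have "AE x in M. nn_cond_exp M F (\<lambda>x. ennreal (h x)) x
      = nn_cond_exp (distr M N T) F' (\<lambda>y. ennreal (f y)) (T x)"
    by (rule nn_cond_exp_distr[OF T F F' sets_F]) (auto simp: hf)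
  moreover have "AE x in M. nn_cond_exp M F (\<lambda>x. ennreal (- h x)) x
      = nn_cond_exp (distr M N T) F' (\<lambda>y. ennreal (- f y)) (T x)"
    by (rule nn_cond_exp_distr[OF T F F' sets_F]) (auto simp: hf)
  ultimately show ?thesis
    by eventually_elim (simp add: real_cond_exp_def)
qed

lemma sets_history_vimage:
  assumes T: "T \<in> space M \<rightarrow> space M'"
    and X: "\<And>k \<omega>. k \<in> {1..i} \<Longrightarrow> \<omega> \<in> space M \<Longrightarrow> X k \<omega> = X' k (T \<omega>)"
  shows "sets (history M d X i) = {T -` A \<inter> space M | A. A \<in> sets (history M' d X' i)}"
proof -
  have eq: "(\<Union>k\<in>{1..i}. {X k -` B \<inter> space M | B. B \<in> sets (Rd d)})
      = {T -` A \<inter> space M | A. A \<in> (\<Union>k\<in>{1..i}. {X' k -` B \<inter> space M' | B. B \<in> sets (Rd d)})}"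
  proof -
    have "X k -` B \<inter> space M = T -` (X' k -` B \<inter> space M') \<inter> space M" if "k \<in> {1..i}" for k B
      using T X[OF that] by auto
    then show ?thesis
      unfolding Setcompr_eq_image image_UN image_image by (intro SUP_cong image_cong refl)
  qed
  show ?thesis
    unfolding sets_history eq by (rule sigma_sets_vimage_commute[OF T, symmetric])
qed

text \<open>
  The map \<open>T\<close> carries all the information of the vectors, so each \<open>\<sigma> i\<close>, being measurable with
  respect to their history, factors through \<open>T\<close>. As \<open>T\<close> is onto, the factor can be read off by
  choosing an arbitrary preimage: \<open>\<sigma> i\<close> is constant on the fibres of \<open>T\<close>, because the level sets
  of \<open>\<sigma> i\<close> belong to the history and are therefore preimages under \<open>T\<close>.
\<close>

lemma norm_subgaussian_mds_distr:
  fixes T :: "'a \<Rightarrow> 'b"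
  assumes M: "prob_space M" and mds: "norm_subgaussian_mds M d n X \<sigma>"
    and T [measurable]: "T \<in> M \<rightarrow>\<^sub>M N" and surj: "T ` space M = space N"
    and X': "\<And>i. i \<in> {1..n} \<Longrightarrow> X' i \<in> N \<rightarrow>\<^sub>M Rd d"
    and X: "\<And>i \<omega>. i \<in> {1..n} \<Longrightarrow> \<omega> \<in> space M \<Longrightarrow> X i \<omega> = X' i (T \<omega>)"
  obtains \<sigma>' where "norm_subgaussian_mds (distr M N T) d n X' \<sigma>'"
    and "\<And>i \<omega>. i \<in> {1..n} \<Longrightarrow> \<omega> \<in> space M \<Longrightarrow> \<sigma> i \<omega> = \<sigma>' i (T \<omega>)"
proof
  interpret M: prob_space M by fact
  let ?N = "distr M N T"
  interpret N: prob_space ?N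
    by (rule M.prob_space_distr) fact
  define \<sigma>' where "\<sigma>' i y = \<sigma> i (SOME \<omega>. \<omega> \<in> space M \<and> T \<omega> = y)" for i y
  have sets_history: "sets (history M d X i) = {T -` A \<inter> space M | A. A \<in> sets (history ?N d X' i)}"
    if "i \<le> n" for i
    using that measurable_space[OF T] by (intro sets_history_vimage) (auto simp: X)
  have F: "finite_measure_subalgebra M (history M d X i)" if "i \<le> n" for i
    by unfold_locales (rule norm_subgaussian_mds_subalgebra[OF mds that])
  have F': "finite_measure_subalgebra ?N (history ?N d X' i)" if "i \<le> n" for i
    by unfold_locales (use X' that in \<open>auto intro!: subalgebra_history\<close>)
  show \<sigma>_eq: "\<sigma> i \<omega> = \<sigma>' i (T \<omega>)" if i: "i \<in> {1..n}" and \<omega>: "\<omega> \<in> space M" for i \<omega>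
  proof -
    have i1: "i - 1 \<le> n" using i by auto
    have "\<sigma> i -` {\<sigma> i \<omega>} \<inter> space M \<in> sets (history M d X (i - 1))"
      using measurable_sets[OF norm_subgaussian_mdsD(2)[OF mds i], of "{\<sigma> i \<omega>}"] by simp
    then have "\<exists>A. \<sigma> i -` {\<sigma> i \<omega>} \<inter> space M = T -` A \<inter> space M \<and> A \<in> sets (history ?N d X' (i - 1))"
      unfolding sets_history[OF i1] by (rule CollectD)
    then obtain A where A: "\<sigma> i -` {\<sigma> i \<omega>} \<inter> space M = T -` A \<inter> space M"
      by auto
    define \<omega>' where "\<omega>' = (SOME \<omega>'. \<omega>' \<in> space M \<and> T \<omega>' = T \<omega>)"
    have "\<omega>' \<in> space M \<and> T \<omega>' = T \<omega>"
      unfolding \<omega>'_def by (rule someI[of _ \<omega>]) (use \<omega> in simp)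
    with A \<omega> have "\<sigma> i \<omega>' = \<sigma> i \<omega>"
      by (metis (no_types, lifting) IntD1 IntI singleton_iff vimage_eq)
    then show ?thesis
      by (simp add: \<sigma>'_def \<omega>'_def)
  qed
  show "norm_subgaussian_mds ?N d n X' \<sigma>'"
    unfolding norm_subgaussian_mds_def
  proof (intro ballI conjI allI impI)
    fix i assume i: "i \<in> {1..n}"
    then have i1: "i - 1 \<le> n" by auto
    note Xi = norm_subgaussian_mdsD[OF mds i]
    note [measurable] = X'[OF i]
    show "X' i \<in> ?N \<rightarrow>\<^sub>M Rd d" by simp
    show "0 < \<sigma>' i y" if y: "y \<in> space ?N" for y
    proof -
      have "y \<in> T ` space M"
        using y surj by simp
      then obtain \<omega> where "\<omega> \<in> space M" "y = T \<omega>"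
        by blast
      then show ?thesis
        using Xi(3) \<sigma>_eq[OF i] by metis
    qed
    show \<sigma>'_meas: "\<sigma>' i \<in> borel_measurable (history ?N d X' (i - 1))"
    proof (rule measurableI)
      fix B :: "real set" assume "B \<in> sets borel"
      then have "\<sigma> i -` B \<inter> space M \<in> sets (history M d X (i - 1))"
        using measurable_sets[OF Xi(2)] by simp
      then have "\<exists>A. \<sigma> i -` B \<inter> space M = T -` A \<inter> space M \<and> A \<in> sets (history ?N d X' (i - 1))"
        unfolding sets_history[OF i1] by (rule CollectD)
      then obtain A where A: "\<sigma> i -` B \<inter> space M = T -` A \<inter> space M"
        and A_sets: "A \<in> sets (history ?N d X' (i - 1))"
        by auto
      have "A \<subseteq> space N"
        using sets.sets_into_space[OF A_sets] by simp
      moreover have "\<sigma>' i y \<in> B \<longleftrightarrow> y \<in> A" if "y \<in> space N" for y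
      proof -
        obtain \<omega> where \<omega>: "\<omega> \<in> space M" "y = T \<omega>"
          using \<open>y \<in> space N\<close>[folded surj] by blast
        then have "\<omega> \<in> \<sigma> i -` B \<inter> space M \<longleftrightarrow> \<omega> \<in> T -` A \<inter> space M"
          using A by simp
        then show ?thesis
          using \<omega> \<sigma>_eq[OF i] by simp
      qed
      ultimately have "\<sigma>' i -` B \<inter> space (history ?N d X' (i - 1)) = A"
        by auto
      then show "\<sigma>' i -` B \<inter> space (history ?N d X' (i - 1)) \<in> sets (history ?N d X' (i - 1))"
        using A_sets by simp
    qed simp
    have [measurable]: "\<sigma>' i \<in> borel_measurable N"
      using measurable_from_subalg[OF finite_measure_subalgebra.subalg[OF F'[OF i1]] \<sigma>'_meas] by simp
    have [measurable]: "real_cond_exp ?N (history ?N d X' (i - 1)) f \<in> borel_measurable N" for f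
      using borel_measurable_cond_exp2[of ?N "history ?N d X' (i - 1)" f] by simp
    show "AE y in ?N. real_cond_exp ?N (history ?N d X' (i - 1)) (\<lambda>y. X' i y j) y = 0" if j: "j < d" for j
    proof (subst AE_distr_iff)
      have "(\<lambda>y. X' i y j) \<in> borel_measurable N" "(\<lambda>\<omega>. X i \<omega> j) \<in> borel_measurable M"
        using measurable_Rd_component[OF X'[OF i] j] measurable_Rd_component[OF Xi(1) j] by auto
      from real_cond_exp_distr[OF T F[OF i1] F'[OF i1] sets_history[OF i1] this] Xi(4)[OF j]
      show "AE \<omega> in M. real_cond_exp ?N (history ?N d X' (i - 1)) (\<lambda>y. X' i y j) (T \<omega>) = 0"
        by (auto simp: X[OF i])
    qed measurable
    show "AE y in ?N. real_cond_exp ?N (history ?N d X' (i - 1))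
          (indicator {y \<in> space ?N. t \<le> enorm d (X' i y)}) y
        \<le> 2 * exp (- (t\<^sup>2 / (2 * (\<sigma>' i y)\<^sup>2)))" if t: "0 \<le> t" for t
    proof (subst AE_distr_iff)
      have [measurable]: "(\<lambda>y. enorm d (X' i y)) \<in> borel_measurable N"
        "(\<lambda>\<omega>. enorm d (X i \<omega>)) \<in> borel_measurable M"
        by (auto intro!: borel_measurable_enorm measurable_Rd_component[OF X'[OF i]]
            measurable_Rd_component[OF Xi(1)])
      have "AE \<omega> in M. real_cond_exp M (history M d X (i - 1))
            (indicator {\<omega> \<in> space M. t \<le> enorm d (X i \<omega>)}) \<omega>
          = real_cond_exp ?N (history ?N d X' (i - 1))
              (indicator {y \<in> space ?N. t \<le> enorm d (X' i y)}) (T \<omega>)"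
        by (rule real_cond_exp_distr[OF T F[OF i1] F'[OF i1] sets_history[OF i1]])
          (use measurable_space[OF T] in \<open>auto simp: X[OF i] split: split_indicator\<close>)
      with Xi(5)[OF t] AE_space
      show "AE \<omega> in M. real_cond_exp ?N (history ?N d X' (i - 1))
            (indicator {y \<in> space ?N. t \<le> enorm d (X' i y)}) (T \<omega>)
          \<le> 2 * exp (- (t\<^sup>2 / (2 * (\<sigma>' i (T \<omega>))\<^sup>2)))"
        by eventually_elim (simp add: \<sigma>_eq[OF i])
    qed measurable
  qed
qed

text \<open>
  The canonical sample space is the range of \<open>\<omega> \<mapsto> (X\<^sub>1 \<omega>, \<dots>, X\<^sub>n \<omega>)\<close>, with the trace of the product
  \<open>\<sigma>\<close>-algebra and the joint distribution. Restricting to the range makes the map onto.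
\<close>

lemma norm_sum_bound_transfer:
  assumes "norm_sum_bound TYPE(canonical) c"
  shows "norm_sum_bound TYPE('a) c"
  unfolding norm_sum_bound_def
proof (intro allI impI)
  fix M :: "'a measure" and d n :: nat and X :: "nat \<Rightarrow> 'a \<Rightarrow> nat \<Rightarrow> real" and \<sigma> :: "nat \<Rightarrow> 'a \<Rightarrow> real"
    and \<delta> \<theta> :: real
  assume M: "prob_space M" and dn: "1 \<le> d" "1 \<le> n" and mds: "norm_subgaussian_mds M d n X \<sigma>"
    and pos: "0 < \<delta>" "0 < \<theta>"
  interpret M: prob_space M by fact
  define T where "T \<omega> = (\<lambda>i\<in>{1..n}. X i \<omega>)" for \<omega>
  define N where "N = restrict_space (PiM {1..n} (\<lambda>_. Rd d)) (T ` space M)"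
  define X' where "X' i y = y i" for i and y :: canonical
  have T_PiM: "T \<in> M \<rightarrow>\<^sub>M PiM {1..n} (\<lambda>_. Rd d)"
    unfolding T_def by (intro measurable_restrict norm_subgaussian_mdsD(1)[OF mds])
  have T [measurable]: "T \<in> M \<rightarrow>\<^sub>M N"
    unfolding N_def by (rule measurable_restrict_space2[OF _ T_PiM]) simp
  have surj: "T ` space M = space N"
    using measurable_space[OF T_PiM] by (auto simp: N_def space_restrict_space)
  have X': "X' i \<in> N \<rightarrow>\<^sub>M Rd d" if "i \<in> {1..n}" for i
    unfolding N_def X'_def by (intro measurable_restrict_space1 measurable_component_singleton that)
  have X: "X i \<omega> = X' i (T \<omega>)" if "i \<in> {1..n}" "\<omega> \<in> space M" for i \<omega>
    using that by (simp add: X'_def T_def)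
  obtain \<sigma>' where mds': "norm_subgaussian_mds (distr M N T) d n X' \<sigma>'"
    and \<sigma>: "\<And>i \<omega>. i \<in> {1..n} \<Longrightarrow> \<omega> \<in> space M \<Longrightarrow> \<sigma> i \<omega> = \<sigma>' i (T \<omega>)"
    using norm_subgaussian_mds_distr[where X' = X', OF M mds T surj X' X] by metis
  define G where "G = {y \<in> space (distr M N T). enorm d (\<lambda>j. \<Sum>i\<in>{1..n}. X' i y j)
      \<le> c * (\<theta> * (\<Sum>i\<in>{1..n}. (\<sigma>' i y)\<^sup>2)) + 1 / \<theta> * ln (2 * real d / \<delta>)}"
  note [measurable] = norm_sum_measurable[OF mds' order_refl] variance_sum_measurable[OF mds']
  have "G \<in> sets (distr M N T)"
    unfolding G_def by measurable
  then have G: "G \<in> sets N" by simp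
  have "1 - \<delta> \<le> measure (distr M N T) G"
    using assms M.prob_space_distr[OF T] dn mds' pos unfolding norm_sum_bound_def G_def by blast
  also have "\<dots> = measure M (T -` G \<inter> space M)"
    by (rule measure_distr[OF T G])
  also have "T -` G \<inter> space M = {\<omega> \<in> space M. enorm d (\<lambda>j. \<Sum>i\<in>{1..n}. X i \<omega> j)
      \<le> c * (\<theta> * (\<Sum>i\<in>{1..n}. (\<sigma> i \<omega>)\<^sup>2)) + 1 / \<theta> * ln (2 * real d / \<delta>)}"
    using measurable_space[OF T] by (auto simp: G_def X \<sigma>)
  finally show "1 - \<delta> \<le> measure M {\<omega> \<in> space M. enorm d (\<lambda>j. \<Sum>i\<in>{1..n}. X i \<omega> j)
      \<le> c * (\<theta> * (\<Sum>i\<in>{1..n}. (\<sigma> i \<omega>)\<^sup>2)) + 1 / \<theta> * ln (2 * real d / \<delta>)}" .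
qed

theorem lemma6:
  shows "(\<exists>c>0. norm_sum_bound TYPE(canonical) c) \<and>
         (\<forall>c>0. norm_sum_bound TYPE(canonical) c \<longrightarrow> norm_sum_bound TYPE('a) c)"
proof (intro conjI allI impI)
  show "\<exists>c>0. norm_sum_bound TYPE(canonical) c"
    by (rule exI[of _ 26]) (simp add: norm_sum_bound_26)
qed (rule norm_sum_bound_transfer)

end
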